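(* Let $N,p\ge 1$, let $\Omega\subset[N]$ be a fixed nonempty set, let $A\in\mathbb{R}^{N\times p}$ be the (deterministic) covariate matrix, $\beta^*\in\mathbb{R}^p$, and suppose the responses $Y_i=A_{i,\cdot}\beta^*+\epsilon_i$, $i\in\Omega$, are observed, where the noise $\epsilon=(\epsilon_i)_{i\in\Omega}$ has independent, mean-zero entries with $\mathrm{Var}(\epsilon_i)\le\sigma^2$ and is independent of the observed covariate matrix $Z$. Let $\widehat A=\mathrm{ME}(Z)\in\mathbb{R}^{N\times p}$ be produced by an arbitrary matrix estimation algorithm (any measurable function of $Z$), let $\widehat\beta=(\widehat A^{\Omega})^{\dagger}Y^{\Omega}$ and $\widehat Y=\widehat A\widehat\beta$. Then $$\mathrm{MSE}_{\Omega}(\widehat Y)\le \frac{1}{|\Omega|}\Big(\|\beta^*\|_1^2\cdot \mathrm{MCSE}_{\Omega}(\widehat A)+2\sigma^2\,\mathbb{E}[\mathrm{rank}(\widehat A^{\Omega})]\Big).$$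
   Context: For $B\in\mathbb{R}^{N\times p}$, $B^{\Omega}$ is the $|\Omega|\times p$ submatrix formed by the rows of $B$ indexed by $\Omega$, and $Y^\Omega=(Y_i)_{i\in\Omega}$; $M^\dagger$ is the Moore–Penrose pseudoinverse. The training error is $\mathrm{MSE}_{\Omega}(\widehat Y)=\frac{1}{|\Omega|}\mathbb{E}\big[\sum_{i\in\Omega}(\widehat Y_i-A_{i,\cdot}\beta^* )^2\big]$ and the max column sum error is $\mathrm{MCSE}_{\Omega}(\widehat A)=\mathbb{E}\big[\max_{j\in[p]}\sum_{i\in\Omega}(\widehat A_{ij}-A_{ij})^2\big]$. Here $Z$ is a random (noisy, partially observed) version of $A$ as in the paper's model, and the estimator $\widehat A$ depends on the data only through $Z$. *)

theory Defs
  imports "HOL-Probability.Probability" "Jordan_Normal_Form.DL_Submatrix" "Jordan_Normal_Form.DL_Rank"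
begin

text \<open>Moore--Penrose pseudoinverse of a real matrix, defined by the four Penrose conditions
  (for real matrices the conjugate transpose is the transpose).\<close>
definition is_mp_pinv :: "real mat \<Rightarrow> real mat \<Rightarrow> bool" where
  "is_mp_pinv B X \<longleftrightarrow> X \<in> carrier_mat (dim_col B) (dim_row B) \<and>
     B * X * B = B \<and> X * B * X = X \<and>
     transpose_mat (B * X) = B * X \<and> transpose_mat (X * B) = X * B"

definition mp_pinv :: "real mat \<Rightarrow> real mat" where
  "mp_pinv B = (THE X. is_mp_pinv B X)"

definition row_sub :: "real mat \<Rightarrow> nat set \<Rightarrow> real mat" where
  "row_sub B Omega = submatrix B Omega {0..<dim_col B}"

definition vec_sub :: "(nat \<Rightarrow> real) \<Rightarrow> nat set \<Rightarrow> real vec" where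
  "vec_sub Y Omega = vec (card Omega) (\<lambda>k. Y (pick Omega k))"

definition l1_norm_vec :: "real vec \<Rightarrow> real" where
  "l1_norm_vec v = (\<Sum>j<dim_vec v. \<bar>v $ j\<bar>)"

end

theory Submission
  imports Defs
begin

text \<open>With B the estimated submatrix and a the true signal on Omega, the fit is P (a + e), where
  P = B (mp_pinv B) is the orthogonal projection onto the column space of B. The error splits orthogonally
  into the bias (I - P) a and the noise P e. Since P fixes the columns of B, the bias only sees
  (A - B) beta, which is bounded by Cauchy--Schwarz. Since P depends on Z alone, the noise has mean
  square at most sigma^2 times the expected trace of P, and trace P = rank B.\<close>

text \<open>The obstacle is that \<open>mp_pinv\<close> is a definite description, which shows
  neither measurability nor any link to the rank, and that the pseudoinverse jumps where the rank of
  its argument changes. It therefore enters only through the product \<open>B * mp_pinv B\<close>,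
  which is identified with an explicit recursion over the columns of \<open>B\<close>. The
  orthogonal splitting holds for every outcome, so no cross term has to be estimated in expectation.
  Entries of a projection are bounded by 1, so the noise term is integrable and its expectation
  factors entry by entry. Of trace = rank only the inequality from trace to rank is proved, and the
  noise costs \<open>sigma\<^sup>2\<close> times the trace; the factor 2 in the bound is a
  weakening. No moments of the estimate are assumed, so the column error may have infinite
  expectation. Hence the final comparison takes place in \<open>ennreal\<close>.\<close>

lemma mat_eqI_mult_vec:
  fixes A B :: "real mat"
  assumes A: "A \<in> carrier_mat n m" and B: "B \<in> carrier_mat n m"
    and eq: "\<And>y. y \<in> carrier_vec m \<Longrightarrow> A *\<^sub>v y = B *\<^sub>v y"
  shows "A = B"
proof (rule eq_matI)
  fix i j assume ij: "i < dim_row B" "j < dim_col B"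
  have "A *\<^sub>v unit_vec m j = col A j" "B *\<^sub>v unit_vec m j = col B j"
    using A B ij by (auto intro!: eq_vecI simp: row_def)
  then have "col A j = col B j" using eq[of "unit_vec m j"] by simp
  then show "A $$ (i, j) = B $$ (i, j)"
    using A B ij by (metis carrier_matD index_col)
qed (use A B in auto)

section \<open>Orthogonal projections as symmetric idempotent matrices\<close>

definition orth_proj :: "nat \<Rightarrow> real mat \<Rightarrow> bool" where
  "orth_proj n P \<longleftrightarrow> P \<in> carrier_mat n n \<and> transpose_mat P = P \<and> P * P = P"

lemma orth_projD:
  assumes "orth_proj n P"
  shows "P \<in> carrier_mat n n" "transpose_mat P = P" "P * P = P"
    and "y \<in> carrier_vec n \<Longrightarrow> P *\<^sub>v (P *\<^sub>v y) = P *\<^sub>v y"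
    and "x \<in> carrier_vec n \<Longrightarrow> y \<in> carrier_vec n \<Longrightarrow> (P *\<^sub>v x) \<bullet> y = x \<bullet> (P *\<^sub>v y)"
proof -
  show P: "P \<in> carrier_mat n n" and t: "transpose_mat P = P" and i: "P * P = P"
    using assms by (auto simp: orth_proj_def)
  show "P *\<^sub>v (P *\<^sub>v y) = P *\<^sub>v y" if "y \<in> carrier_vec n"
    using assoc_mult_mat_vec[OF P P that] i by simp
  show "(P *\<^sub>v x) \<bullet> y = x \<bullet> (P *\<^sub>v y)" if "x \<in> carrier_vec n" "y \<in> carrier_vec n"
    using transpose_vec_mult_scalar[OF P that(2,1)] t by simp
qed

lemma orth_projI:
  assumes P: "P \<in> carrier_mat n n" and "transpose_mat P = P"
    and i: "\<And>y. y \<in> carrier_vec n \<Longrightarrow> P *\<^sub>v (P *\<^sub>v y) = P *\<^sub>v y"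
  shows "orth_proj n P"
  unfolding orth_proj_def
proof (intro conjI mat_eqI_mult_vec[of _ n n])
  show "P * P *\<^sub>v y = P *\<^sub>v y" if "y \<in> carrier_vec n" for y
    using assoc_mult_mat_vec[OF P P that] i[OF that] by simp
qed (use assms in auto)

text \<open>Since P = P P^T, a diagonal entry is the squared length of its row. Nonnegativity of the
  diagonal and the bound on all entries both rest on this.\<close>

lemma orth_proj_diag:
  assumes "orth_proj n P" "i < n"
  shows "P $$ (i, i) = (\<Sum>k<n. (P $$ (i, k))\<^sup>2)"
proof -
  note P = orth_projD[OF assms(1)]
  have sym: "P $$ (k, i) = P $$ (i, k)" if "k < n" for k
    using P(1,2) assms(2) that by (metis carrier_matD index_transpose_mat(1))
  have "P $$ (i, i) = (P * P) $$ (i, i)" using P(3) by simp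
  also have "\<dots> = (\<Sum>k<n. P $$ (i, k) * P $$ (k, i))"
    using P(1) assms(2) by (auto simp: scalar_prod_def lessThan_atLeast0)
  finally show ?thesis using sym by (simp add: power2_eq_square)
qed

text \<open>The diagonal entry d of row i dominates the square of every entry of that row. Its own
  square gives d^2 \<le> d, so d \<le> 1, and the other entries follow.\<close>

lemma orth_proj_entry_le_1:
  assumes "orth_proj n P" "i < n" "k < n"
  shows "\<bar>P $$ (i, k)\<bar> \<le> 1"
proof -
  have "(P $$ (i, l))\<^sup>2 \<le> P $$ (i, i)" if "l < n" for l
    unfolding orth_proj_diag[OF assms(1,2)] using that by (intro member_le_sum) auto
  from this[OF assms(2)] this[OF assms(3)]
  have a: "(P $$ (i, i))\<^sup>2 \<le> P $$ (i, i)" and b: "(P $$ (i, k))\<^sup>2 \<le> P $$ (i, i)" by auto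
  have "P $$ (i, i) \<le> 1"
  proof (rule ccontr)
    assume "\<not> P $$ (i, i) \<le> 1"
    then have "P $$ (i, i) * 1 < P $$ (i, i) * P $$ (i, i)" by (intro mult_strict_left_mono) auto
    then show False using a by (simp add: power2_eq_square)
  qed
  with b have "(P $$ (i, k))\<^sup>2 \<le> 1" by simp
  then show ?thesis using abs_square_le_1 by blast
qed

lemma orth_proj_diag_nonneg:
  assumes "orth_proj n P" "i < n"
  shows "0 \<le> P $$ (i, i)"
  unfolding orth_proj_diag[OF assms] by (intro sum_nonneg) auto

section \<open>Rank-one updates and the projection onto the column space\<close>

definition line_proj :: "real vec \<Rightarrow> real mat" where
  "line_proj r = mat (dim_vec r) (dim_vec r) (\<lambda>(i, k). r $ i * r $ k / (r \<bullet> r))"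

lemma line_proj_carrier: "r \<in> carrier_vec n \<Longrightarrow> line_proj r \<in> carrier_mat n n"
  by (auto simp: line_proj_def)

lemma line_proj_mult_vec:
  assumes "r \<in> carrier_vec n" "y \<in> carrier_vec n"
  shows "line_proj r *\<^sub>v y = ((r \<bullet> y) / (r \<bullet> r)) \<cdot>\<^sub>v r"
  using assms
  by (intro eq_vecI) (auto simp: line_proj_def scalar_prod_def row_def sum_divide_distrib sum_distrib_left mult_ac
      intro!: sum.cong)

lemma scalar_prod_self_eq_0:
  "r \<in> carrier_vec n \<Longrightarrow> (r :: real vec) \<bullet> r = 0 \<longleftrightarrow> r = 0\<^sub>v n"
  using conjugate_square_eq_0_vec[of r n] by (simp add: scalar_prod_def conjugate_vec_def)

lemma line_proj_trace:
  assumes "r \<in> carrier_vec n"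
  shows "(\<Sum>i<n. line_proj r $$ (i, i)) = (if r = 0\<^sub>v n then 0 else 1)"
proof -
  have "(\<Sum>i<n. line_proj r $$ (i, i)) = (r \<bullet> r) / (r \<bullet> r)"
    using assms by (auto simp: line_proj_def scalar_prod_def sum_divide_distrib[symmetric] lessThan_atLeast0)
  then show ?thesis using scalar_prod_self_eq_0[OF assms] assms by auto
qed


text \<open>The residual \<open>r\<close> is orthogonal to the range of \<open>P\<close>, so
  \<open>P\<close> and the projection onto the line of \<open>r\<close> annihilate each other. Their
  sum is then again a projection, and its range has gained \<open>v\<close>.\<close>

lemma orth_proj_extend:
  assumes P: "orth_proj n P" and v: "v \<in> carrier_vec n"
  defines "r \<equiv> v - P *\<^sub>v v"
  shows "orth_proj n (P + line_proj r)"
    and "(P + line_proj r) *\<^sub>v v = v"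
    and "u \<in> carrier_vec n \<Longrightarrow> P *\<^sub>v u = u \<Longrightarrow> (P + line_proj r) *\<^sub>v u = u"
proof -
  note PD = orth_projD[OF P]
  have r: "r \<in> carrier_vec n" using v PD(1) by (auto simp: r_def)
  have Pc: "P *\<^sub>v y \<in> carrier_vec n" for y
    using PD(1) by (intro carrier_vecI) auto
  have Pr: "P *\<^sub>v r = 0\<^sub>v n"
    unfolding r_def using PD(4)[OF v] v Pc mult_minus_distrib_mat_vec[OF PD(1) v Pc] by auto
  have rP: "r \<bullet> (P *\<^sub>v y) = 0" if "y \<in> carrier_vec n" for y
    using PD(5)[OF r that] Pr that by simp
  let ?Q = "P + line_proj r"
  have Q: "?Q *\<^sub>v y = P *\<^sub>v y + ((r \<bullet> y) / (r \<bullet> r)) \<cdot>\<^sub>v r" if "y \<in> carrier_vec n" for y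
    using add_mult_distrib_mat_vec[OF PD(1) line_proj_carrier[OF r] that]
      line_proj_mult_vec[OF r that] by simp
  show "orth_proj n ?Q"
  proof (rule orth_projI)
    show "?Q \<in> carrier_mat n n" using PD(1) line_proj_carrier[OF r] by auto
    have "transpose_mat (line_proj r) = line_proj r"
      by (rule eq_matI) (auto simp: line_proj_def mult.commute)
    then show "transpose_mat ?Q = ?Q"
      using transpose_add[OF PD(1) line_proj_carrier[OF r]] PD(2) by simp
    fix y :: "real vec" assume y: "y \<in> carrier_vec n"
    define c where "c = (r \<bullet> y) / (r \<bullet> r)"
    have Qy: "?Q *\<^sub>v y = P *\<^sub>v y + c \<cdot>\<^sub>v r" unfolding c_def by (rule Q[OF y])
    have Qyc: "P *\<^sub>v y + c \<cdot>\<^sub>v r \<in> carrier_vec n" using Pc r by auto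
    have "r \<bullet> (P *\<^sub>v y + c \<cdot>\<^sub>v r) = c * (r \<bullet> r)"
      using scalar_prod_add_distrib[OF r Pc, of "c \<cdot>\<^sub>v r"] rP[OF y] r by simp
    then have "(r \<bullet> (P *\<^sub>v y + c \<cdot>\<^sub>v r)) / (r \<bullet> r) = c" by (simp add: c_def)
    moreover have "c \<cdot>\<^sub>v 0\<^sub>v n = (0\<^sub>v n :: real vec)" by auto
    then have "P *\<^sub>v (P *\<^sub>v y + c \<cdot>\<^sub>v r) = P *\<^sub>v y"
      using mult_add_distrib_mat_vec[OF PD(1) Pc, of "c \<cdot>\<^sub>v r" y] mult_mat_vec[OF PD(1) r, of c] Pr PD(4)[OF y] r Pc
      by simp
    ultimately show "?Q *\<^sub>v (?Q *\<^sub>v y) = ?Q *\<^sub>v y"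
      unfolding Qy Q[OF Qyc] by simp
  qed
  \<comment> \<open>As \<open>r\<close> is orthogonal to \<open>P *\<^sub>v v\<close>, the
    coefficient of \<open>r\<close> in \<open>?Q *\<^sub>v v\<close> is 1 whenever \<open>r\<close>
    is nonzero.\<close>
  have rv: "r \<bullet> v = r \<bullet> r"
    using scalar_prod_minus_distrib[OF r v Pc] rP[OF v] by (simp add: r_def)
  show "?Q *\<^sub>v v = v"
  proof (cases "r = 0\<^sub>v n")
    case True
    then have "v - P *\<^sub>v v = 0\<^sub>v n" by (simp add: r_def)
    then have "P *\<^sub>v v = v"
      using v Pc[of v] by (metis carrier_vecD eq_vecI index_minus_vec(1) index_zero_vec(1) right_minus_eq)
    moreover have "((r \<bullet> v) / (r \<bullet> r)) \<cdot>\<^sub>v r = 0\<^sub>v n" using True by auto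
    ultimately show ?thesis using Q[OF v] v by simp
  next
    case False
    then have "(r \<bullet> v) / (r \<bullet> r) = 1" using rv scalar_prod_self_eq_0[OF r] by simp
    then have "?Q *\<^sub>v v = P *\<^sub>v v + r" using Q[OF v] by simp
    also have "\<dots> = v" unfolding r_def using v PD(1) by (intro eq_vecI) auto
    finally show ?thesis .
  qed
  assume u: "u \<in> carrier_vec n" "P *\<^sub>v u = u"
  then have "(r \<bullet> u) / (r \<bullet> r) = 0" using rP[OF u(1)] by simp
  then have "((r \<bullet> u) / (r \<bullet> r)) \<cdot>\<^sub>v r = 0\<^sub>v n" using r by (intro eq_vecI) auto
  then show "?Q *\<^sub>v u = u" using Q[OF u(1)] u by simp
qed

text \<open>Building P = B (mp_pinv B) column by column, as in Gram--Schmidt, makes its entries visibly measurable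
  in B and lets the trace count an independent set of columns. If the j-th column is already in the
  span then the residual is 0, and the division by 0 in line_proj contributes the zero matrix.\<close>
fun gs_proj :: "real mat \<Rightarrow> nat \<Rightarrow> real mat" where
  "gs_proj B 0 = 0\<^sub>m (dim_row B) (dim_row B)"
| "gs_proj B (Suc j) = gs_proj B j + line_proj (col B j - gs_proj B j *\<^sub>v col B j)"

lemma gs_proj_orth_proj:
  assumes "B \<in> carrier_mat n p" "j \<le> p"
  shows "orth_proj n (gs_proj B j)"
  using assms(2)
proof (induction j)
  case 0
  then show ?case using assms by (auto simp: orth_proj_def)
next
  case (Suc j)
  then show ?case using orth_proj_extend(1)[of n "gs_proj B j" "col B j"] assms by auto
qed

lemma gs_proj_carrier: "gs_proj B j \<in> carrier_mat (dim_row B) (dim_row B)"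
  by (induction j) (auto simp: line_proj_def)

lemma gs_proj_fixes_col:
  assumes B: "B \<in> carrier_mat n p" and "j \<le> p" "i < j"
  shows "gs_proj B j *\<^sub>v col B i = col B i"
  using assms(2,3)
proof (induction j)
  case (Suc j)
  have o: "orth_proj n (gs_proj B j)" using gs_proj_orth_proj[OF B] Suc by simp
  have c: "col B k \<in> carrier_vec n" for k using B by auto
  show ?case
  proof (cases "i = j")
    case True
    then show ?thesis using orth_proj_extend(2)[OF o c] by simp
  next
    case False
    then show ?thesis using orth_proj_extend(3)[OF o c c] Suc by simp
  qed
qed auto

text \<open>The induction is over all \<open>y\<close> because its hypothesis is used twice: at
  \<open>y\<close>, and at the new column \<open>v\<close>, where it places the residual in the
  column space of \<open>B\<close>.\<close>

lemma gs_proj_range: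
  assumes B: "B \<in> carrier_mat n p" and "j \<le> p" and y: "y \<in> carrier_vec n"
  shows "\<exists>x\<in>carrier_vec p. gs_proj B j *\<^sub>v y = B *\<^sub>v x"
  using assms(2) y
proof (induction j arbitrary: y)
  case 0
  then show ?case using B by (intro bexI[of _ "0\<^sub>v p"]) auto
next
  case (Suc j)
  define v where "v = col B j"
  have v: "v \<in> carrier_vec n" using B by (auto simp: v_def)
  have vB: "v = B *\<^sub>v unit_vec p j"
    unfolding v_def using B Suc.prems by (intro eq_vecI) (auto simp: row_def)
  have P: "gs_proj B j \<in> carrier_mat n n" using gs_proj_carrier[of B j] B by auto
  define r where "r = v - gs_proj B j *\<^sub>v v"
  have r: "r \<in> carrier_vec n" using v P by (auto simp: r_def)
  obtain x where x: "x \<in> carrier_vec p" "gs_proj B j *\<^sub>v y = B *\<^sub>v x" using Suc by auto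
  obtain z where z: "z \<in> carrier_vec p" "gs_proj B j *\<^sub>v v = B *\<^sub>v z" using Suc v by auto
  define c where "c = (r \<bullet> y) / (r \<bullet> r)"
  define w where "w = unit_vec p j - z"
  have w: "w \<in> carrier_vec p" using z by (auto simp: w_def)
  have "gs_proj B (Suc j) *\<^sub>v y = B *\<^sub>v x + c \<cdot>\<^sub>v r"
    using add_mult_distrib_mat_vec[OF P line_proj_carrier[OF r] Suc.prems(2)]
      line_proj_mult_vec[OF r Suc.prems(2)] x by (simp add: r_def v_def c_def)
  also have "r = B *\<^sub>v w"
    unfolding r_def w_def using mult_minus_distrib_mat_vec[OF B _ z(1), of "unit_vec p j"] vB z(2) by simp
  also have "B *\<^sub>v x + c \<cdot>\<^sub>v (B *\<^sub>v w) = B *\<^sub>v (x + c \<cdot>\<^sub>v w)"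
    using mult_add_distrib_mat_vec[OF B x(1), of "c \<cdot>\<^sub>v w"] mult_mat_vec[OF B w] w by simp
  finally show ?case using x w by (intro bexI[of _ "x + c \<cdot>\<^sub>v w"]) auto
qed

text \<open>The two facts state that the range of the projection contains the column space of
  \<open>B\<close> and is contained in it. Besides the projection laws, they are all that the
  comparison with the pseudoinverse uses.\<close>

lemma gs_proj_factor:
  assumes B: "B \<in> carrier_mat n p"
  shows "gs_proj B p * B = B" and "\<exists>W\<in>carrier_mat p n. gs_proj B p = B * W"
proof -
  have P: "gs_proj B p \<in> carrier_mat n n" using gs_proj_carrier[of B p] B by auto
  show "gs_proj B p * B = B"
  proof (rule mat_col_eqI)
    fix j assume "j < dim_col B"
    then show "col (gs_proj B p * B) j = col B j"
      using gs_proj_fixes_col[OF B, of p j] col_mult2[OF P B] B by auto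
  qed (use P B in auto)
  obtain x where x: "\<And>y. y \<in> carrier_vec n \<Longrightarrow> x y \<in> carrier_vec p \<and> gs_proj B p *\<^sub>v y = B *\<^sub>v x y"
    using gs_proj_range[OF B order_refl] by metis
  define W where "W = mat p n (\<lambda>(i, k). x (unit_vec n k) $ i)"
  have W: "W \<in> carrier_mat p n" by (auto simp: W_def)
  have "gs_proj B p = B * W"
  proof (rule mat_col_eqI)
    fix k assume "k < dim_col (B * W)"
    then have k: "k < n" using W by auto
    have "col W k = x (unit_vec n k)" using x[of "unit_vec n k"] k by (auto simp: W_def)
    then have "col (B * W) k = gs_proj B p *\<^sub>v unit_vec n k"
      using col_mult2[OF B W k] x[of "unit_vec n k"] by simp
    also have "\<dots> = col (gs_proj B p) k" using P k by (intro eq_vecI) (auto simp: row_def)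
    finally show "col (gs_proj B p) k = col (B * W) k" by simp
  qed (use P B W in auto)
  then show "\<exists>W\<in>carrier_mat p n. gs_proj B p = B * W" using W by auto
qed

section \<open>Trace of the projection and rank\<close>

text \<open>The vectors fixed by \<open>P\<close> form a submodule, and a submodule containing
  \<open>U\<close> contains its span.\<close>

lemma (in vec_space) span_subset_fixed:
  fixes P :: "'a mat"
  assumes P: "P \<in> carrier_mat n n" and U: "U \<subseteq> carrier_vec n"
    and fixed: "\<And>u. u \<in> U \<Longrightarrow> P *\<^sub>v u = u" and v: "v \<in> span U"
  shows "P *\<^sub>v v = v"
proof -
  let ?F = "{v \<in> carrier_vec n. P *\<^sub>v v = v}"
  have "submodule class_ring ?F V"
  proof (rule submodule.intro)
    show "module class_ring V" by (rule module_axioms)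
    show "?F \<subseteq> carrier V" by auto
    show "\<zero>\<^bsub>V\<^esub> \<in> ?F" using P by (auto simp: module_vec_simps)
    show "v \<oplus>\<^bsub>V\<^esub> w \<in> ?F" if "v \<in> ?F" "w \<in> ?F" for v w
      using that mult_add_distrib_mat_vec[OF P, of v w] by (simp add: module_vec_simps)
    show "c \<odot>\<^bsub>V\<^esub> v \<in> ?F" if "v \<in> ?F" for c v
      using that mult_mat_vec[OF P, of v c] by (simp add: module_vec_simps)
  qed
  then have "span U \<subseteq> ?F" using span_is_subset[of U ?F] U fixed by auto
  then show ?thesis using v by auto
qed

text \<open>A nonzero residual adds 1 to the trace and its column to \<open>U\<close>. Independence
  survives: a column in the span of \<open>U\<close> would be fixed by the current projection, and
  its residual would vanish. Columns rather than residuals are collected because independent columns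
  bound the rank from below.\<close>

lemma gs_proj_trace_indpt:
  assumes B: "B \<in> carrier_mat n p" and "j \<le> p"
  shows "\<exists>U. finite U \<and> U \<subseteq> col B ` {..<j} \<and> \<not> module.lin_dep class_ring (module_vec TYPE(real) n) U \<and>
    (\<Sum>i<n. gs_proj B j $$ (i, i)) = real (card U)"
  using assms(2)
proof (induction j)
  case 0
  interpret vec_space "TYPE(real)" n .
  have "lin_indpt {}" by (metis empty_iff lin_dep_def subset_empty)
  then show ?case using B by (intro exI[of _ "{}"]) auto
next
  case (Suc j)
  interpret vec_space "TYPE(real)" n .
  let ?P = "gs_proj B j"
  let ?v = "col B j"
  define r where "r = ?v - ?P *\<^sub>v ?v"
  obtain U where U: "finite U" "U \<subseteq> col B ` {..<j}" "lin_indpt U"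
    "(\<Sum>i<n. ?P $$ (i, i)) = real (card U)" using Suc by auto
  have cB: "col B i \<in> carrier_vec n" for i using B by auto
  then have v: "?v \<in> carrier_vec n" .
  have P: "?P \<in> carrier_mat n n" using gs_proj_carrier[of B j] B by auto
  have r: "r \<in> carrier_vec n" using v P by (auto simp: r_def)
  have tr: "(\<Sum>i<n. gs_proj B (Suc j) $$ (i, i)) = real (card U) + (if r = 0\<^sub>v n then 0 else 1)"
    using U(4) line_proj_trace[OF r] P line_proj_carrier[OF r] by (simp add: sum.distrib r_def)
  have Uc: "U \<subseteq> carrier_vec n" using U(2) cB by blast
  show ?case
  proof (cases "r = 0\<^sub>v n")
    case True
    then show ?thesis using U(1-3) tr by (intro exI[of _ U]) auto
  next
    case False
    have "?v \<notin> span U"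
    proof
      assume "?v \<in> span U"
      moreover have "?P *\<^sub>v u = u" if "u \<in> U" for u
        using that U(2) gs_proj_fixes_col[OF B, of j] Suc.prems by auto
      ultimately have "?P *\<^sub>v ?v = ?v" using span_subset_fixed[OF P Uc] by blast
      then show False using False v by (simp add: r_def)
    qed
    moreover from this have "?v \<notin> U" using in_own_span[OF Uc] by auto
    ultimately have "lin_indpt (insert ?v U)" "card (insert ?v U) = card U + 1"
      using lin_dep_iff_in_span[of U ?v] U(3) Uc v U(1) by simp_all
    moreover have "insert ?v U \<subseteq> col B ` {..<Suc j}" using U(2) by fastforce
    ultimately show ?thesis using U(1) tr False by (intro exI[of _ "insert ?v U"]) simp
  qed
qed

lemma gs_proj_trace_le_rank:
  assumes B: "B \<in> carrier_mat n p"
  shows "(\<Sum>i<n. gs_proj B p $$ (i, i)) \<le> real (vec_space.rank n B)"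
proof -
  obtain U where U: "U \<subseteq> col B ` {..<p}" "\<not> module.lin_dep class_ring (module_vec TYPE(real) n) U"
    "(\<Sum>i<n. gs_proj B p $$ (i, i)) = real (card U)" using gs_proj_trace_indpt[OF B order_refl] by auto
  have "U \<subseteq> set (cols B)" using U(1) B by (auto simp: cols_def)
  then show ?thesis using vec_space.rank_ge_card_indpt[OF B _ U(2)] U(3) by simp
qed


section \<open>Existence and uniqueness of the Moore--Penrose inverse\<close>

text \<open>By B X B = B = B Y B, each of the symmetric matrices B X and B Y absorbs the other, so
  transposing a product gives B X = B Y, and likewise X B = Y B. Then X = X B X = X B Y = Y B Y =
  Y.\<close>

lemma is_mp_pinv_unique:
  assumes X: "is_mp_pinv B X" and Y: "is_mp_pinv B Y"
  shows "X = Y"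
proof -
  define n p where "n = dim_row B" and "p = dim_col B"
  have B: "B \<in> carrier_mat n p" by (auto simp: n_def p_def)
  have XC: "X \<in> carrier_mat p n" and YC: "Y \<in> carrier_mat p n"
    and x: "B * X * B = B" "X * B * X = X" "transpose_mat (B * X) = B * X" "transpose_mat (X * B) = X * B"
    and y: "B * Y * B = B" "Y * B * Y = Y" "transpose_mat (B * Y) = B * Y" "transpose_mat (Y * B) = Y * B"
    using X Y by (auto simp: is_mp_pinv_def n_def p_def)
  have BX: "B * X \<in> carrier_mat n n" and BY: "B * Y \<in> carrier_mat n n"
    and XB: "X * B \<in> carrier_mat p p" and YB: "Y * B \<in> carrier_mat p p" using B XC YC by auto
  have "(B * Y) * (B * X) = B * Y * B * X" using assoc_mult_mat[OF BY B XC] by simp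
  then have 1: "(B * Y) * (B * X) = B * X" using y by simp
  have "(B * X) * (B * Y) = B * X * B * Y" using assoc_mult_mat[OF BX B YC] by simp
  then have 2: "(B * X) * (B * Y) = B * Y" using x by simp
  have "B * X = transpose_mat ((B * Y) * (B * X))" using 1 x by simp
  also have "\<dots> = B * Y" using transpose_mult[OF BY BX] x y 2 by simp
  finally have BXY: "B * X = B * Y" .
  have "(X * B) * (Y * B) = X * (B * Y * B)"
    using assoc_mult_mat[OF XC B YB] assoc_mult_mat[OF B YC B] by simp
  then have 3: "(X * B) * (Y * B) = X * B" using y by simp
  have "(Y * B) * (X * B) = Y * (B * X * B)"
    using assoc_mult_mat[OF YC B XB] assoc_mult_mat[OF B XC B] by simp
  then have 4: "(Y * B) * (X * B) = Y * B" using x by simp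
  have "X * B = transpose_mat ((X * B) * (Y * B))" using 3 x by simp
  also have "\<dots> = Y * B" using transpose_mult[OF XB YB] x y 4 by simp
  finally have XYB: "X * B = Y * B" .
  have "X = X * (B * X)" using x assoc_mult_mat[OF XC B XC] by simp
  also have "\<dots> = (Y * B) * Y" using BXY XYB assoc_mult_mat[OF XC B YC] by simp
  finally show ?thesis using y by simp
qed

text \<open>The aim is an \<open>X\<close> for which \<open>B * X\<close> and \<open>X * B\<close>
  are the orthogonal projections \<open>P\<close> and \<open>Q\<close> onto the column spaces of
  \<open>B\<close> and of its transpose. The Penrose conditions then reduce to symmetry of
  \<open>P\<close> and \<open>Q\<close>, \<open>P * B = B\<close> and
  \<open>Q * X = X\<close>.\<close>

lemma is_mp_pinv_exists:
  "\<exists>X. is_mp_pinv B X"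
proof -
  define n p where "n = dim_row B" and "p = dim_col B"
  have B: "B \<in> carrier_mat n p" by (auto simp: n_def p_def)
  then have BT: "transpose_mat B \<in> carrier_mat p n" by auto
  define P Q where "P = gs_proj B p" and "Q = gs_proj (transpose_mat B) n"
  note Pp = orth_projD[OF gs_proj_orth_proj[OF B order_refl, folded P_def]]
    and Qp = orth_projD[OF gs_proj_orth_proj[OF BT order_refl, folded Q_def]]
  obtain W where W: "W \<in> carrier_mat p n" "P = B * W"
    using gs_proj_factor(2)[OF B] by (auto simp: P_def)
  obtain V where V: "V \<in> carrier_mat n p" "Q = transpose_mat B * V"
    using gs_proj_factor(2)[OF BT] by (auto simp: Q_def)
  have PB: "P * B = B" using gs_proj_factor(1)[OF B] by (simp add: P_def)
  have "transpose_mat (Q * transpose_mat B) = B"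
    using gs_proj_factor(1)[OF BT] by (simp add: Q_def)
  then have BQ: "B * Q = B" using transpose_mult[OF Qp(1) BT] Qp(2) by simp
  define V' where "V' = transpose_mat V"
  have V': "V' \<in> carrier_mat p n" using V by (simp add: V'_def)
  \<comment> \<open>Symmetry of \<open>Q\<close> moves \<open>B\<close> to the right end of its
    factorization, where it meets \<open>W * B\<close> and \<open>B * W * B = P * B = B\<close>
    applies.\<close>
  have "transpose_mat Q = V' * B" using transpose_mult[OF BT V(1)] V(2) by (simp add: V'_def)
  then have QV: "Q = V' * B" using Qp(2) by simp
  have VB: "V' * B \<in> carrier_mat p p" using V' B by auto
  \<comment> \<open>W inverts B up to the projections P and Q onto its column and row spaces.\<close>
  define X where "X = Q * W * P"
  have QW: "Q * W \<in> carrier_mat p n" using Qp W by auto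
  have X: "X \<in> carrier_mat p n" using QW Pp by (auto simp: X_def)
  have "B * X = B * (Q * W) * P" unfolding X_def using assoc_mult_mat[OF B QW Pp(1)] by simp
  also have "B * (Q * W) = P" using assoc_mult_mat[OF B Qp(1) W(1)] BQ W(2) by simp
  finally have BX: "B * X = P" using Pp(3) by simp
  have "X * B = Q * W * B" unfolding X_def using assoc_mult_mat[OF QW Pp(1) B] PB by simp
  also have "\<dots> = V' * (B * (W * B))"
    unfolding QV using assoc_mult_mat[OF VB W(1) B] assoc_mult_mat[OF V' B, of "W * B" p] V' B W by simp
  also have "B * (W * B) = B" using assoc_mult_mat[OF B W(1) B] W(2) PB by simp
  finally have XB: "X * B = Q" using QV by simp
  have "Q * X = Q * Q * W * P"
    unfolding X_def using assoc_mult_mat[OF Qp(1) QW Pp(1)] assoc_mult_mat[OF Qp(1) Qp(1) W(1)] by simp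
  then have "Q * X = X" using Qp(3) by (simp add: X_def)
  then have "is_mp_pinv B X"
    unfolding is_mp_pinv_def using X BX XB PB Pp(2) Qp(2) by (simp add: n_def p_def)
  then show ?thesis ..
qed

lemma is_mp_pinv_mp_pinv: "is_mp_pinv B (mp_pinv B)"
  unfolding mp_pinv_def using is_mp_pinv_exists is_mp_pinv_unique by (metis theI)

lemma mp_pinv_carrier: "B \<in> carrier_mat n p \<Longrightarrow> mp_pinv B \<in> carrier_mat p n"
  using is_mp_pinv_mp_pinv[of B] by (auto simp: is_mp_pinv_def)

text \<open>With X the pseudoinverse, P B = B gives P (B X) = B X, while P = B W and B X B = B give
  (B X) P = P. Both matrices are symmetric, so transposing the first identity makes them
  equal.\<close>

lemma mult_mp_pinv_eq_gs_proj:
  assumes B: "B \<in> carrier_mat n p"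
  shows "B * mp_pinv B = gs_proj B p"
proof -
  define P where "P = gs_proj B p"
  let ?X = "mp_pinv B"
  note Pp = orth_projD[OF gs_proj_orth_proj[OF B order_refl, folded P_def]]
  have X: "?X \<in> carrier_mat p n" and BXB: "B * ?X * B = B" and t: "transpose_mat (B * ?X) = B * ?X"
    using is_mp_pinv_mp_pinv[of B] B by (auto simp: is_mp_pinv_def)
  have BX: "B * ?X \<in> carrier_mat n n" using B X by auto
  obtain W where W: "W \<in> carrier_mat p n" "P = B * W"
    using gs_proj_factor(2)[OF B] by (auto simp: P_def)
  have PB: "P * B = B" using gs_proj_factor(1)[OF B] by (simp add: P_def)
  have "P * (B * ?X) = B * ?X" using assoc_mult_mat[OF Pp(1) B X] PB by simp
  then have "transpose_mat (P * (B * ?X)) = B * ?X" using t by simp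
  then have "B * ?X = B * ?X * P" using transpose_mult[OF Pp(1) BX] t Pp(2) by simp
  also have "\<dots> = P" using assoc_mult_mat[OF BX B W(1)] BXB W(2) by simp
  finally show ?thesis by (simp add: P_def)
qed

section \<open>Error bound for a fixed outcome\<close>

text \<open>Cauchy--Schwarz with the weight split evenly between both factors. Leaving a weight on
  each square lets the columns later be bounded by their maximum.\<close>

lemma weighted_sum_sq_le:
  fixes b c :: "'a \<Rightarrow> real"
  shows "(\<Sum>j\<in>J. b j * c j)\<^sup>2 \<le> (\<Sum>j\<in>J. \<bar>b j\<bar>) * (\<Sum>j\<in>J. \<bar>b j\<bar> * (c j)\<^sup>2)"
proof -
  have eq: "b j * c j = sqrt \<bar>b j\<bar> * (sgn (b j) * sqrt \<bar>b j\<bar> * c j)" for j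
    by (simp add: sgn_if)
  have "(\<Sum>j\<in>J. b j * c j)\<^sup>2 = (\<Sum>j\<in>J. sqrt \<bar>b j\<bar> * (sgn (b j) * sqrt \<bar>b j\<bar> * c j))\<^sup>2"
    by (simp only: eq)
  also have "\<dots> \<le> (\<Sum>j\<in>J. (sqrt \<bar>b j\<bar>)\<^sup>2) * (\<Sum>j\<in>J. (sgn (b j) * sqrt \<bar>b j\<bar> * c j)\<^sup>2)"
    by (rule Cauchy_Schwarz_ineq_sum)
  also have "(\<Sum>j\<in>J. (sgn (b j) * sqrt \<bar>b j\<bar> * c j)\<^sup>2) = (\<Sum>j\<in>J. \<bar>b j\<bar> * (c j)\<^sup>2)"
    by (intro sum.cong) (auto simp: power_mult_distrib sgn_if)
  finally show ?thesis by simp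
qed

text \<open>One factor of the l1 norm comes from Cauchy--Schwarz in each row. The other appears
  after exchanging the sums, when every column sum in the weighted total is replaced by the largest
  one.\<close>

lemma mult_vec_norm_le_max_col:
  assumes D: "D \<in> carrier_mat n p" and beta: "beta \<in> carrier_vec p" and "p \<ge> 1"
  shows "(\<Sum>k<n. ((D *\<^sub>v beta) $ k)\<^sup>2) \<le>
    (l1_norm_vec beta)\<^sup>2 * Max ((\<lambda>j. \<Sum>k<n. (D $$ (k, j))\<^sup>2) ` {..<p})"
proof -
  let ?c = "\<lambda>j. \<Sum>k<n. (D $$ (k, j))\<^sup>2"
  let ?l = "\<Sum>j<p. \<bar>beta $ j\<bar>"
  have "(\<Sum>k<n. ((D *\<^sub>v beta) $ k)\<^sup>2) = (\<Sum>k<n. (\<Sum>j<p. beta $ j * D $$ (k, j))\<^sup>2)"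
    using D beta by (auto simp: scalar_prod_def lessThan_atLeast0 mult.commute intro!: sum.cong)
  also have "\<dots> \<le> (\<Sum>k<n. ?l * (\<Sum>j<p. \<bar>beta $ j\<bar> * (D $$ (k, j))\<^sup>2))"
    by (intro sum_mono weighted_sum_sq_le)
  also have "\<dots> = ?l * (\<Sum>j<p. \<bar>beta $ j\<bar> * ?c j)"
    by (simp add: sum_distrib_left) (rule sum.swap)
  also have "\<dots> \<le> ?l * (\<Sum>j<p. \<bar>beta $ j\<bar> * Max (?c ` {..<p}))"
    by (intro mult_left_mono sum_mono sum_nonneg Max_ge) auto
  also have "\<dots> = (l1_norm_vec beta)\<^sup>2 * Max (?c ` {..<p})"
    using beta by (simp add: l1_norm_vec_def power2_eq_square sum_distrib_right[symmetric] mult.assoc)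
  finally show ?thesis .
qed

lemma scalar_prod_self_sum: "v \<in> carrier_vec n \<Longrightarrow> v \<bullet> v = (\<Sum>k<n. (v $ k)\<^sup>2)"
  for v :: "real vec"
  by (auto simp: scalar_prod_def lessThan_atLeast0 power2_eq_square)

lemma orth_proj_residual_le:
  assumes P: "orth_proj n P" and x: "x \<in> carrier_vec n"
  shows "(x - P *\<^sub>v x) \<bullet> (x - P *\<^sub>v x) \<le> x \<bullet> x"
proof -
  note PD = orth_projD[OF P]
  have Px: "P *\<^sub>v x \<in> carrier_vec n" using PD(1) x by auto
  have "x \<bullet> (P *\<^sub>v x) = (P *\<^sub>v x) \<bullet> (P *\<^sub>v x)" using PD(4)[OF x] PD(5)[OF x Px] by simp
  moreover have "(P *\<^sub>v x) \<bullet> x = x \<bullet> (P *\<^sub>v x)" using PD(5)[OF x x] .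
  ultimately have "(x - P *\<^sub>v x) \<bullet> (x - P *\<^sub>v x) = x \<bullet> x - (P *\<^sub>v x) \<bullet> (P *\<^sub>v x)"
    using x Px by (simp add: minus_scalar_prod_distrib[of _ n] scalar_prod_minus_distrib[of _ n])
  moreover have "0 \<le> (P *\<^sub>v x) \<bullet> (P *\<^sub>v x)" using scalar_prod_self_sum[OF Px] by (simp add: sum_nonneg)
  ultimately show ?thesis by simp
qed

text \<open>The double sum separates entries of \<open>P\<close> from products of noise entries,
  which is the form in which independence can be applied termwise.\<close>

lemma orth_proj_quadratic_form:
  assumes P: "orth_proj n P" and e: "e \<in> carrier_vec n"
  shows "(\<Sum>i<n. \<Sum>k<n. P $$ (i, k) * (e $ i * e $ k)) = (P *\<^sub>v e) \<bullet> (P *\<^sub>v e)"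
proof -
  note PD = orth_projD[OF P]
  have Pe: "P *\<^sub>v e \<in> carrier_vec n" using PD(1) e by auto
  have "(\<Sum>i<n. \<Sum>k<n. P $$ (i, k) * (e $ i * e $ k)) = e \<bullet> (P *\<^sub>v e)"
    using PD(1) e by (auto simp: scalar_prod_def lessThan_atLeast0 sum_distrib_left mult_ac intro!: sum.cong)
  then show ?thesis using PD(4)[OF e] PD(5)[OF e Pe] by simp
qed

lemma orth_proj_quadratic_form_nonneg:
  assumes P: "orth_proj n P" and e: "e \<in> carrier_vec n"
  shows "0 \<le> (\<Sum>i<n. \<Sum>k<n. P $$ (i, k) * (e $ i * e $ k))"
proof -
  have "P *\<^sub>v e \<in> carrier_vec n" using orth_projD(1)[OF P] e by auto
  then show ?thesis
    unfolding orth_proj_quadratic_form[OF assms] using scalar_prod_self_sum by (simp add: sum_nonneg)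
qed

lemma projection_error_le:
  assumes B: "B \<in> carrier_mat n p" and G: "G \<in> carrier_mat n p"
    and P: "orth_proj n P" and PB: "P * B = B"
    and beta: "beta \<in> carrier_vec p" and e: "e \<in> carrier_vec n" and "p \<ge> 1"
  shows "(\<Sum>k<n. ((P *\<^sub>v (G *\<^sub>v beta + e) - G *\<^sub>v beta) $ k)\<^sup>2) \<le>
    (l1_norm_vec beta)\<^sup>2 * Max ((\<lambda>j. \<Sum>k<n. (B $$ (k, j) - G $$ (k, j))\<^sup>2) ` {..<p})
     + (\<Sum>i<n. \<Sum>k<n. P $$ (i, k) * (e $ i * e $ k))"
proof -
  note PD = orth_projD[OF P]
  define a where "a = G *\<^sub>v beta"
  define x where "x = (G - B) *\<^sub>v beta"
  define s where "s = x - P *\<^sub>v x"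
  define t where "t = P *\<^sub>v e"
  have c: "a \<in> carrier_vec n" "x \<in> carrier_vec n" "s \<in> carrier_vec n" "t \<in> carrier_vec n" "B *\<^sub>v beta \<in> carrier_vec n"
    "P *\<^sub>v a \<in> carrier_vec n" "P *\<^sub>v x \<in> carrier_vec n"
    using B G PD(1) beta e by (auto simp: a_def x_def s_def t_def intro!: carrier_vecI)
  have x: "x = a - B *\<^sub>v beta" unfolding x_def a_def by (rule minus_mult_distrib_mat_vec[OF G B beta])
  have "P *\<^sub>v (B *\<^sub>v beta) = B *\<^sub>v beta" using assoc_mult_mat_vec[OF PD(1) B beta] PB by simp
  then have Px: "P *\<^sub>v x = P *\<^sub>v a - B *\<^sub>v beta"
    unfolding x using mult_minus_distrib_mat_vec[OF PD(1) c(1) c(5)] by simp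
  \<comment> \<open>Here \<open>s = a - P *\<^sub>v a\<close>: \<open>P\<close> fixes
    \<open>B *\<^sub>v beta\<close>, so passing from \<open>a\<close> to \<open>x\<close> leaves the
    residual unchanged.\<close>
  have dec: "P *\<^sub>v (a + e) - a = t - s"
    unfolding s_def Px mult_add_distrib_mat_vec[OF PD(1) c(1) e] unfolding x t_def[symmetric]
    using c B PD(1) by (intro eq_vecI) auto
  have "P *\<^sub>v s = 0\<^sub>v n"
    unfolding s_def using mult_minus_distrib_mat_vec[OF PD(1) c(2) c(7)] PD(4)[OF c(2)] c by auto
  then have ts: "t \<bullet> s = 0" unfolding t_def using PD(5)[OF e c(3)] e by simp
  then have st: "s \<bullet> t = 0" using comm_scalar_prod[OF c(3,4)] by simp
  have "(\<Sum>k<n. ((P *\<^sub>v (a + e) - a) $ k)\<^sup>2) = (t - s) \<bullet> (t - s)"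
    unfolding dec using scalar_prod_self_sum[of "t - s" n] c by simp
  also have "\<dots> = t \<bullet> t + s \<bullet> s"
    using ts st c by (simp add: minus_scalar_prod_distrib[of _ n] scalar_prod_minus_distrib[of _ n])
  also have "s \<bullet> s \<le> x \<bullet> x" unfolding s_def by (rule orth_proj_residual_le[OF P c(2)])
  also have "x \<bullet> x \<le> (l1_norm_vec beta)\<^sup>2 * Max ((\<lambda>j. \<Sum>k<n. ((G - B) $$ (k, j))\<^sup>2) ` {..<p})"
    unfolding scalar_prod_self_sum[OF c(2)] unfolding x_def
    using B G beta assms(7) by (intro mult_vec_norm_le_max_col) auto
  also have "(\<lambda>j. \<Sum>k<n. ((G - B) $$ (k, j))\<^sup>2) ` {..<p} = (\<lambda>j. \<Sum>k<n. (B $$ (k, j) - G $$ (k, j))\<^sup>2) ` {..<p}"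
    using B G by (intro image_cong sum.cong) (auto simp: power2_commute)
  also have "t \<bullet> t = (\<Sum>i<n. \<Sum>k<n. P $$ (i, k) * (e $ i * e $ k))"
    unfolding t_def orth_proj_quadratic_form[OF P e] ..
  finally show ?thesis by (simp add: a_def add.commute)
qed


section \<open>Rows selected by an index set\<close>

text \<open>\<open>pick\<close> is strictly increasing below the cardinality, hence injective, and
  counting makes it onto.\<close>

lemma bij_betw_pick:
  assumes "finite S"
  shows "bij_betw (pick S) {..<card S} S"
proof -
  have "inj_on (pick S) {..<card S}"
    by (intro linorder_inj_onI) (use pick_mono_le in \<open>force+\<close>)
  moreover have "pick S ` {..<card S} \<subseteq> S" using pick_in_set_le by auto
  ultimately show ?thesis
    using card_subset_eq[OF assms, of "pick S ` {..<card S}"] by (auto simp: bij_betw_def card_image)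
qed

lemma pick_atLeastLessThan: "j < p \<Longrightarrow> pick {0..<p} j = j"
proof (induction j)
  case (Suc j)
  then show ?case by (auto intro!: Least_equality)
qed (auto intro!: Least_equality)

lemma row_sub_carrier:
  assumes B: "B \<in> carrier_mat N p" and O: "Omega \<subseteq> {..<N}"
  shows "row_sub B Omega \<in> carrier_mat (card Omega) p"
proof -
  have "{i. i < N \<and> i \<in> Omega} = Omega" using O by auto
  then show ?thesis using B by (intro carrier_matI) (simp_all add: row_sub_def dim_submatrix)
qed

lemma row_sub_index:
  assumes B: "B \<in> carrier_mat N p" and O: "Omega \<subseteq> {..<N}" and "k < card Omega" "j < p"
  shows "row_sub B Omega $$ (k, j) = B $$ (pick Omega k, j)"
proof -
  have "{i. i < N \<and> i \<in> Omega} = Omega" using O by auto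
  then show ?thesis using assms
    by (simp add: row_sub_def submatrix_index pick_atLeastLessThan)
qed

lemma row_sub_mult_vec:
  assumes B: "B \<in> carrier_mat N p" and O: "Omega \<subseteq> {..<N}" and k: "k < card Omega" and x: "x \<in> carrier_vec p"
  shows "(row_sub B Omega *\<^sub>v x) $ k = (B *\<^sub>v x) $ pick Omega k"
proof -
  have "pick Omega k < N" using pick_in_set_le[OF k] O by auto
  then show ?thesis
    using row_sub_carrier[OF B O] row_sub_index[OF B O k] B k x
    by (simp add: scalar_prod_def carrier_matD carrier_vecD)
qed

section \<open>Measurability, independence and the expected noise\<close>

text \<open>Unfolding the recursion expresses each entry through sums, products and quotients of
  entries of \<open>B\<close>. Division with value 0 at denominator 0 is Borel measurable, so the
  jumps of the projection at rank changes do no harm.\<close>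

lemma measurable_gs_proj:
  fixes B :: "'z \<Rightarrow> real mat"
  assumes B: "\<And>z. B z \<in> carrier_mat n p"
    and m: "\<And>i j. i < n \<Longrightarrow> j < p \<Longrightarrow> (\<lambda>z. B z $$ (i, j)) \<in> borel_measurable M"
    and "l \<le> p" "i < n" "k < n"
  shows "(\<lambda>z. gs_proj (B z) l $$ (i, k)) \<in> borel_measurable M"
  using assms(3-5)
proof (induction l arbitrary: i k)
  case 0
  have "dim_row (B z) = n" for z using B[of z] by auto
  then show ?case using 0 by simp
next
  case (Suc l)
  define r where "r z i = B z $$ (i, l) - (\<Sum>k<n. gs_proj (B z) l $$ (i, k) * B z $$ (k, l))" for z i
  have r: "(\<lambda>z. r z i) \<in> borel_measurable M" if "i < n" for i
    unfolding r_def using that Suc m by (intro borel_measurable_diff borel_measurable_sum borel_measurable_times) auto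
  have "gs_proj (B z) (Suc l) $$ (i, k) = gs_proj (B z) l $$ (i, k) + r z i * r z k / (\<Sum>j<n. r z j * r z j)" for z
  proof -
    have P: "gs_proj (B z) l \<in> carrier_mat n n" using gs_proj_carrier[of "B z" l] B[of z] by auto
    have "(col (B z) l - gs_proj (B z) l *\<^sub>v col (B z) l) = vec n (r z)"
      using P B[of z] Suc.prems
      by (intro eq_vecI) (auto simp: r_def scalar_prod_def lessThan_atLeast0)
    then show ?thesis
      using P Suc.prems by (simp add: line_proj_def scalar_prod_def lessThan_atLeast0)
  qed
  moreover have "(\<lambda>z. gs_proj (B z) l $$ (i, k) + r z i * r z k / (\<Sum>j<n. r z j * r z j)) \<in> borel_measurable M"
    using Suc r by (intro borel_measurable_add borel_measurable_divide borel_measurable_sum borel_measurable_times) auto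
  ultimately show ?case by simp
qed

lemma (in prob_space) indep_vars_imp_indep_var:
  assumes "indep_vars M' X I" "i \<in> I" "k \<in> I" "i \<noteq> k"
  shows "indep_var (M' i) (X i) (M' k) (X k)"
proof -
  have "indep_var (M' i) ((\<lambda>f. f i) \<circ> (\<lambda>w. restrict (\<lambda>l. X l w) {i}))
      (M' k) ((\<lambda>f. f k) \<circ> (\<lambda>w. restrict (\<lambda>l. X l w) {k}))"
    using assms by (intro indep_var_compose[OF indep_var_restrict[OF assms(1)]] measurable_component_singleton) auto
  then show ?thesis by (simp add: comp_def)
qed

text \<open>Applying a measurable map can only shrink the generated sigma-algebra. Independence is
  assumed through sigma-algebras because \<open>indep_var\<close> requires both variables to have
  the same value type, unlike \<open>Z\<close> and the noise vector.\<close>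

lemma (in prob_space) indep_var_compose_indep_set:
  assumes ind: "indep_set (sigma_sets (space M) {X -` A \<inter> space M | A. A \<in> sets S})
      (sigma_sets (space M) {Y -` A \<inter> space M | A. A \<in> sets T})"
    and X: "X \<in> measurable M S" and Y: "Y \<in> measurable M T"
    and f: "f \<in> measurable S N" and g: "g \<in> measurable T N'"
  shows "indep_var N (\<lambda>w. f (X w)) N' (\<lambda>w. g (Y w))"
proof -
  have sub: "sigma_sets (space M) {(\<lambda>w. h (Z w)) -` A \<inter> space M | A. A \<in> sets L}
      \<subseteq> sigma_sets (space M) {Z -` A \<inter> space M | A. A \<in> sets K}"
    if Z: "Z \<in> measurable M K" and h: "h \<in> measurable K L" for Z h K L
  proof (rule sigma_sets_subseteq, safe)
    fix A assume "A \<in> sets L"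
    then have "h -` A \<inter> space K \<in> sets K" using h by (rule measurable_sets[rotated])
    moreover have "(\<lambda>w. h (Z w)) -` A \<inter> space M = Z -` (h -` A \<inter> space K) \<inter> space M"
      using measurable_space[OF Z] by auto
    ultimately show "\<exists>A'. (\<lambda>w. h (Z w)) -` A \<inter> space M = Z -` A' \<inter> space M \<and> A' \<in> sets K" by blast
  qed
  show ?thesis
    unfolding indep_var_eq
  proof (intro conjI)
    show "(\<lambda>w. f (X w)) \<in> measurable M N" "(\<lambda>w. g (Y w)) \<in> measurable M N'"
      using X Y f g by simp_all
    show "indep_set (sigma_sets (space M) {(\<lambda>w. f (X w)) -` A \<inter> space M | A. A \<in> sets N})
        (sigma_sets (space M) {(\<lambda>w. g (Y w)) -` A \<inter> space M | A. A \<in> sets N'})"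
      using ind sub[OF X f] sub[OF Y g] unfolding indep_sets2_eq by blast
  qed
qed

text \<open>Every term factors by independence. Off the diagonal the noise factor is a product of
  two zero means; on it the noise factor is a variance, and \<open>Qnn\<close> allows multiplying
  its bound by the mean of \<open>Q w i i\<close>.\<close>

lemma (in prob_space) expectation_quadratic_form_le:
  fixes Q :: "'a \<Rightarrow> nat \<Rightarrow> nat \<Rightarrow> real" and e :: "'a \<Rightarrow> nat \<Rightarrow> real"
  assumes "finite I"
    and Qm: "\<And>i k. i \<in> I \<Longrightarrow> k \<in> I \<Longrightarrow> (\<lambda>w. Q w i k) \<in> borel_measurable M"
    and Qb: "\<And>w i k. i \<in> I \<Longrightarrow> k \<in> I \<Longrightarrow> \<bar>Q w i k\<bar> \<le> 1"
    and Qnn: "\<And>w i. i \<in> I \<Longrightarrow> 0 \<le> Q w i i"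
    and indQ: "\<And>i k. i \<in> I \<Longrightarrow> k \<in> I \<Longrightarrow> indep_var borel (\<lambda>w. Q w i k) borel (\<lambda>w. e w i * e w k)"
    and ind: "\<And>i k. i \<in> I \<Longrightarrow> k \<in> I \<Longrightarrow> i \<noteq> k \<Longrightarrow> indep_var borel (\<lambda>w. e w i) borel (\<lambda>w. e w k)"
    and e1: "\<And>i. i \<in> I \<Longrightarrow> integrable M (\<lambda>w. e w i)"
    and e2: "\<And>i. i \<in> I \<Longrightarrow> integrable M (\<lambda>w. (e w i)\<^sup>2)"
    and e0: "\<And>i. i \<in> I \<Longrightarrow> expectation (\<lambda>w. e w i) = 0"
    and ev: "\<And>i. i \<in> I \<Longrightarrow> variance (\<lambda>w. e w i) \<le> s"
  shows "integrable M (\<lambda>w. \<Sum>i\<in>I. \<Sum>k\<in>I. Q w i k * (e w i * e w k))"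
    and "expectation (\<lambda>w. \<Sum>i\<in>I. \<Sum>k\<in>I. Q w i k * (e w i * e w k)) \<le> s * expectation (\<lambda>w. \<Sum>i\<in>I. Q w i i)"
proof -
  have eint: "integrable M (\<lambda>w. e w i * e w k)" if "i \<in> I" "k \<in> I" for i k
  proof (cases "i = k")
    case True
    then show ?thesis using e2[OF that(1)] by (simp add: power2_eq_square)
  next
    case False
    then show ?thesis using indep_var_integrable[OF ind e1 e1] that by auto
  qed
  have Qint: "integrable M (\<lambda>w. Q w i k)" if "i \<in> I" "k \<in> I" for i k
    using Qm[OF that] Qb[OF that] by (intro integrable_const_bound[where B = 1]) auto
  have int: "integrable M (\<lambda>w. Q w i k * (e w i * e w k))" if "i \<in> I" "k \<in> I" for i k
    using indep_var_integrable[OF indQ Qint eint] that by auto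
  then show "integrable M (\<lambda>w. \<Sum>i\<in>I. \<Sum>k\<in>I. Q w i k * (e w i * e w k))" by auto
  have off: "expectation (\<lambda>w. Q w i k * (e w i * e w k)) = 0" if "i \<in> I" "k \<in> I" "i \<noteq> k" for i k
    using indep_var_lebesgue_integral[OF indQ Qint eint] indep_var_lebesgue_integral[OF ind e1 e1] e0 that by auto
  have diag: "expectation (\<lambda>w. Q w i i * (e w i * e w i)) \<le> s * expectation (\<lambda>w. Q w i i)" if "i \<in> I" for i
  proof -
    have "expectation (\<lambda>w. e w i * e w i) \<le> s" using ev[OF that] e0[OF that] by (simp add: power2_eq_square)
    moreover have "0 \<le> expectation (\<lambda>w. Q w i i)" using Qnn[OF that] by simp
    ultimately show ?thesis
      using indep_var_lebesgue_integral[OF indQ Qint eint] that by (simp add: mult.commute[of s] mult_left_mono)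
  qed
  have "expectation (\<lambda>w. \<Sum>i\<in>I. \<Sum>k\<in>I. Q w i k * (e w i * e w k))
      = (\<Sum>i\<in>I. \<Sum>k\<in>I. expectation (\<lambda>w. Q w i k * (e w i * e w k)))"
    using int by (simp add: Bochner_Integration.integral_sum)
  also have "\<dots> = (\<Sum>i\<in>I. \<Sum>k\<in>I. if k = i then expectation (\<lambda>w. Q w i i * (e w i * e w i)) else 0)"
    using off by (intro sum.cong) auto
  also have "\<dots> = (\<Sum>i\<in>I. expectation (\<lambda>w. Q w i i * (e w i * e w i)))"
    using \<open>finite I\<close> by simp
  also have "\<dots> \<le> (\<Sum>i\<in>I. s * expectation (\<lambda>w. Q w i i))" by (intro sum_mono diag)
  also have "\<dots> = s * expectation (\<lambda>w. \<Sum>i\<in>I. Q w i i)"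
    using Qint by (simp add: Bochner_Integration.integral_sum sum_distrib_left)
  finally show "expectation (\<lambda>w. \<Sum>i\<in>I. \<Sum>k\<in>I. Q w i k * (e w i * e w k)) \<le> s * expectation (\<lambda>w. \<Sum>i\<in>I. Q w i i)" .
qed

theorem mainTheorem1:
  fixes M :: "'w measure" and MZ :: "'z measure"
    and N p :: nat and Omega :: "nat set"
    and A :: "real mat" and beta :: "real vec"
    and Z :: "'w \<Rightarrow> 'z" and ME :: "'z \<Rightarrow> real mat"
    and eps :: "'w \<Rightarrow> nat \<Rightarrow> real" and sigma :: real
  assumes "prob_space M"
    and "N \<ge> 1" and "p \<ge> 1"
    and "Omega \<subseteq> {..<N}" and "Omega \<noteq> {}"
    and "A \<in> carrier_mat N p" and "beta \<in> carrier_vec p"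
    and "Z \<in> measurable M MZ"
    and "\<And>z. ME z \<in> carrier_mat N p"
    and "\<And>i j. i < N \<Longrightarrow> j < p \<Longrightarrow> (\<lambda>z. ME z $$ (i, j)) \<in> borel_measurable MZ"
    and "\<And>i. i \<in> Omega \<Longrightarrow> (\<lambda>w. eps w i) \<in> borel_measurable M"
    and "prob_space.indep_vars M (\<lambda>_. borel) (\<lambda>i w. eps w i) Omega"
    and "prob_space.indep_set M
           (sigma_sets (space M) {Z -` B \<inter> space M | B. B \<in> sets MZ})
           (sigma_sets (space M) {(\<lambda>w. restrict (eps w) Omega) -` B \<inter> space M | B.
                                    B \<in> sets (PiM Omega (\<lambda>_. (borel :: real measure)))})"
    and "\<And>i. i \<in> Omega \<Longrightarrow> integrable M (\<lambda>w. eps w i)"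
    and "\<And>i. i \<in> Omega \<Longrightarrow> integrable M (\<lambda>w. (eps w i)\<^sup>2)"
    and "\<And>i. i \<in> Omega \<Longrightarrow> prob_space.expectation M (\<lambda>w. eps w i) = 0"
    and "\<And>i. i \<in> Omega \<Longrightarrow> prob_space.variance M (\<lambda>w. eps w i) \<le> sigma\<^sup>2"
  shows
    "(let Y = (\<lambda>w i. (A *\<^sub>v beta) $ i + eps w i);
          Ahat = (\<lambda>w. ME (Z w));
          betahat = (\<lambda>w. mp_pinv (row_sub (Ahat w) Omega) *\<^sub>v vec_sub (Y w) Omega);
          Yhat = (\<lambda>w. Ahat w *\<^sub>v betahat w);
          MSE = ennreal (1 / real (card Omega)) *
                (\<integral>\<^sup>+ w. ennreal (\<Sum>i\<in>Omega. (Yhat w $ i - (A *\<^sub>v beta) $ i)\<^sup>2) \<partial>M);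
          MCSE = (\<integral>\<^sup>+ w. ennreal (Max ((\<lambda>j. \<Sum>i\<in>Omega. (Ahat w $$ (i, j) - A $$ (i, j))\<^sup>2) ` {..<p})) \<partial>M);
          ERank = (\<integral>\<^sup>+ w. ennreal (real (vec_space.rank (card Omega) (row_sub (Ahat w) Omega))) \<partial>M)
      in MSE \<le> ennreal (1 / real (card Omega)) *
                (ennreal ((l1_norm_vec beta)\<^sup>2) * MCSE + ennreal (2 * sigma\<^sup>2) * ERank))"
proof -
  interpret prob_space M by fact
  note O = assms(4) and A = assms(6) and beta = assms(7) and Z = assms(8) and ME = assms(9) and MEm = assms(10)
  define n where "n = card Omega"
  have fin: "finite Omega" using O finite_subset by blast
  define B where "B z = row_sub (ME z) Omega" for z
  define G where "G = row_sub A Omega"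
  define P where "P z = gs_proj (B z) p" for z
  define e where "e w = vec_sub (eps w) Omega" for w
  define l where "l = (l1_norm_vec beta)\<^sup>2"
  define S where "S w = (\<Sum>i\<in>Omega. ((ME (Z w) *\<^sub>v (mp_pinv (row_sub (ME (Z w)) Omega) *\<^sub>v
      vec_sub (\<lambda>i. (A *\<^sub>v beta) $ i + eps w i) Omega)) $ i - (A *\<^sub>v beta) $ i)\<^sup>2)" for w
  define Mx where "Mx w = Max ((\<lambda>j. \<Sum>i\<in>Omega. (ME (Z w) $$ (i, j) - A $$ (i, j))\<^sup>2) ` {..<p})" for w
  define rk where "rk w = real (vec_space.rank (card Omega) (row_sub (ME (Z w)) Omega))" for w
  define q where "q w = (\<Sum>i<n. \<Sum>k<n. P (Z w) $$ (i, k) * (eps w (pick Omega i) * eps w (pick Omega k)))" for w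
  have B: "B z \<in> carrier_mat n p" for z unfolding B_def n_def by (rule row_sub_carrier[OF ME O])
  have G: "G \<in> carrier_mat n p" unfolding G_def n_def by (rule row_sub_carrier[OF A O])
  have P: "orth_proj n (P z)" for z unfolding P_def by (rule gs_proj_orth_proj[OF B order_refl])
  have Pc: "P z \<in> carrier_mat n n" for z using orth_projD(1)[OF P] .
  have e: "e w \<in> carrier_vec n" and ei: "i < n \<Longrightarrow> e w $ i = eps w (pick Omega i)" for w i
    by (auto simp: e_def vec_sub_def n_def)
  have pick: "pick Omega k \<in> Omega" if "k < n" for k using that pick_in_set_le by (simp add: n_def)
  have reindex: "(\<Sum>i\<in>Omega. f i) = (\<Sum>k<n. f (pick Omega k))" for f :: "nat \<Rightarrow> real"
    unfolding n_def by (rule sum.reindex_bij_betw[OF bij_betw_pick[OF fin], symmetric])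
  have q: "q w = (\<Sum>i<n. \<Sum>k<n. P (Z w) $$ (i, k) * (e w $ i * e w $ k))" for w
    unfolding q_def by (intro sum.cong) (simp_all add: ei)
  have q0: "0 \<le> q w" for w unfolding q by (rule orth_proj_quadratic_form_nonneg[OF P e])
  \<comment> \<open>Nonnegativity is needed to distribute \<open>ennreal\<close> over
    \<open>l * Mx w + q w\<close>; column 0 serves as witness because
    \<open>p \<ge> 1\<close>.\<close>
  have Mx0: "0 \<le> Mx w" for w
  proof -
    have "0 \<le> (\<Sum>i\<in>Omega. (ME (Z w) $$ (i, 0) - A $$ (i, 0))\<^sup>2)" by (simp add: sum_nonneg)
    also have "\<dots> \<le> Mx w" unfolding Mx_def using assms(3) by (intro Max_ge) auto
    finally show ?thesis .
  qed
  have pointwise: "S w \<le> l * Mx w + q w" for w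
  proof -
    define b where "b = mp_pinv (B (Z w))"
    define y where "y = vec_sub (\<lambda>i. (A *\<^sub>v beta) $ i + eps w i) Omega"
    have b: "b \<in> carrier_mat p n" unfolding b_def by (rule mp_pinv_carrier[OF B])
    have y: "y = G *\<^sub>v beta + e w"
    proof (rule eq_vecI)
      fix k assume "k < dim_vec (G *\<^sub>v beta + e w)"
      then have "k < n" using e[of w] by simp
      then show "y $ k = (G *\<^sub>v beta + e w) $ k"
        using row_sub_mult_vec[OF A O _ beta, of k] e[of w] ei[of k w]
        by (simp add: y_def vec_sub_def n_def G_def)
    qed (use e[of w] in \<open>simp add: y_def vec_sub_def n_def\<close>)
    have yc: "y \<in> carrier_vec n" by (auto simp: y_def vec_sub_def n_def)
    have yb: "b *\<^sub>v y \<in> carrier_vec p" using b yc by auto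
    \<comment> \<open>Restricting the prediction to the rows in \<open>Omega\<close> turns the full
      estimate into \<open>B (Z w)\<close>, and \<open>B (Z w) * b\<close> is the
      projection.\<close>
    have fit: "(ME (Z w) *\<^sub>v (b *\<^sub>v y)) $ pick Omega k = (P (Z w) *\<^sub>v y) $ k" if "k < n" for k
      using row_sub_mult_vec[OF ME O _ yb, of k "Z w"] that
        assoc_mult_mat_vec[OF B b yc, of "Z w"] mult_mp_pinv_eq_gs_proj[OF B, of "Z w"]
      by (simp add: n_def B_def b_def P_def)
    have "S w = (\<Sum>k<n. ((P (Z w) *\<^sub>v (G *\<^sub>v beta + e w) - G *\<^sub>v beta) $ k)\<^sup>2)"
      unfolding S_def reindex B_def[symmetric] b_def[symmetric] y_def[symmetric]
    proof (rule sum.cong)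
      fix k assume "k \<in> {..<n}"
      then have k: "k < n" by simp
      have "(A *\<^sub>v beta) $ pick Omega k = (G *\<^sub>v beta) $ k"
        using row_sub_mult_vec[OF A O _ beta, of k] k by (simp add: n_def G_def)
      then show "((ME (Z w) *\<^sub>v (b *\<^sub>v y)) $ pick Omega k - (A *\<^sub>v beta) $ pick Omega k)\<^sup>2
          = ((P (Z w) *\<^sub>v (G *\<^sub>v beta + e w) - G *\<^sub>v beta) $ k)\<^sup>2"
        using fit[OF k] k y G by simp
    qed simp
    also have "\<dots> \<le> l * Max ((\<lambda>j. \<Sum>k<n. (B (Z w) $$ (k, j) - G $$ (k, j))\<^sup>2) ` {..<p}) + q w"
      unfolding l_def q
      using projection_error_le[OF B G P _ beta e assms(3)] gs_proj_factor(1)[OF B] by (simp add: P_def)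
    also have "(\<lambda>j. \<Sum>k<n. (B (Z w) $$ (k, j) - G $$ (k, j))\<^sup>2) ` {..<p}
        = (\<lambda>j. \<Sum>i\<in>Omega. (ME (Z w) $$ (i, j) - A $$ (i, j))\<^sup>2) ` {..<p}"
      unfolding reindex using row_sub_index[OF ME O] row_sub_index[OF A O]
      by (intro image_cong sum.cong) (simp_all add: B_def G_def n_def)
    finally show ?thesis by (simp add: Mx_def)
  qed
  have Pm: "(\<lambda>z. P z $$ (i, k)) \<in> borel_measurable MZ" if "i < n" "k < n" for i k
    unfolding P_def
  proof (rule measurable_gs_proj[OF B _ order_refl that])
    fix i j assume ij: "i < n" "j < p"
    then have "pick Omega i < N" using pick O by auto
    then show "(\<lambda>z. B z $$ (i, j)) \<in> borel_measurable MZ"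
      using row_sub_index[OF ME O _ ij(2), of i] ij MEm[of "pick Omega i" j] by (simp add: B_def n_def)
  qed
  have Mxm: "Mx \<in> borel_measurable M"
    unfolding Mx_def
  proof (intro borel_measurable_Max borel_measurable_sum borel_measurable_power borel_measurable_diff)
    fix i j assume "j \<in> {..<p}" "i \<in> Omega"
    then show "(\<lambda>w. ME (Z w) $$ (i, j)) \<in> borel_measurable M"
      using measurable_compose[OF Z MEm] O by auto
  qed auto
  have epsm: "(\<lambda>w. restrict (eps w) Omega) \<in> measurable M (PiM Omega (\<lambda>_. borel))"
    using assms(11) by (intro measurable_restrict)
  have ind: "indep_var borel (\<lambda>w. P (Z w) $$ (i, k)) borel (\<lambda>w. eps w (pick Omega i) * eps w (pick Omega k))"
    if "i < n" "k < n" for i k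
  proof -
    have "(\<lambda>f. f (pick Omega i) * f (pick Omega k) :: real) \<in> borel_measurable (PiM Omega (\<lambda>_. borel))"
      using pick that by (intro borel_measurable_times measurable_component_singleton)
    \<comment> \<open>The projection entry is a function of \<open>Z\<close> alone, and the product
      a function of the noise vector restricted to \<open>Omega\<close>.\<close>
    from indep_var_compose_indep_set[OF assms(13) Z epsm Pm[OF that] this]
    show ?thesis using pick that by simp
  qed
  have pick_inj: "pick Omega i \<noteq> pick Omega k" if "i < n" "k < n" "i \<noteq> k" for i k
    using bij_betw_pick[OF fin] that by (auto simp: bij_betw_def inj_on_def n_def)
  have quad: "integrable M q" "expectation q \<le> sigma\<^sup>2 * expectation (\<lambda>w. \<Sum>i<n. P (Z w) $$ (i, i))"
    unfolding q_def using pick pick_inj Pm Z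
    by (auto intro!: expectation_quadratic_form_le orth_proj_entry_le_1[OF P] orth_proj_diag_nonneg[OF P] ind
        indep_vars_imp_indep_var[OF assms(12)] assms(14-17) measurable_compose[OF Z])
  have tr_int: "integrable M (\<lambda>w. \<Sum>i<n. P (Z w) $$ (i, i))"
    using orth_proj_entry_le_1[OF P] measurable_compose[OF Z Pm]
    by (intro Bochner_Integration.integrable_sum integrable_const_bound[where B = 1]) auto
  have tr0: "0 \<le> (\<Sum>i<n. P (Z w) $$ (i, i))" for w
    using orth_proj_diag_nonneg[OF P] by (intro sum_nonneg) auto
  have "(\<integral>\<^sup>+ w. ennreal (q w) \<partial>M) = ennreal (expectation q)"
    using quad(1) q0 by (intro nn_integral_eq_integral) auto
  also have "\<dots> \<le> ennreal (sigma\<^sup>2 * expectation (\<lambda>w. \<Sum>i<n. P (Z w) $$ (i, i)))"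
    using quad(2) by (rule ennreal_leI)
  also have "\<dots> = ennreal (sigma\<^sup>2) * (\<integral>\<^sup>+ w. ennreal (\<Sum>i<n. P (Z w) $$ (i, i)) \<partial>M)"
    using tr_int tr0 by (subst nn_integral_eq_integral) (auto simp: ennreal_mult' integral_nonneg_AE)
  \<comment> \<open>Trace is replaced by rank and \<open>sigma\<^sup>2\<close> by twice its value.
    Monotonicity of the integral holds for arbitrary integrands, so the rank may enter without a
    measurability proof.\<close>
  also have "\<dots> \<le> ennreal (2 * sigma\<^sup>2) * (\<integral>\<^sup>+ w. ennreal (rk w) \<partial>M)"
    using gs_proj_trace_le_rank[OF B]
    by (intro mult_mono nn_integral_mono ennreal_leI) (auto simp: rk_def P_def B_def n_def)
  finally have noise: "(\<integral>\<^sup>+ w. ennreal (q w) \<partial>M) \<le> ennreal (2 * sigma\<^sup>2) * (\<integral>\<^sup>+ w. ennreal (rk w) \<partial>M)" .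
  have l0: "0 \<le> l" by (simp add: l_def)
  have "(\<integral>\<^sup>+ w. ennreal (S w) \<partial>M) \<le> (\<integral>\<^sup>+ w. ennreal l * ennreal (Mx w) + ennreal (q w) \<partial>M)"
  proof (rule nn_integral_mono)
    fix w
    have "ennreal (S w) \<le> ennreal (l * Mx w + q w)" using pointwise by (rule ennreal_leI)
    then show "ennreal (S w) \<le> ennreal l * ennreal (Mx w) + ennreal (q w)"
      using l0 Mx0[of w] q0[of w] by (simp add: ennreal_mult)
  qed
  \<comment> \<open>Splitting the integral is where measurability of \<open>Mx\<close> and
    \<open>q\<close> is used.\<close>
  also have "\<dots> = ennreal l * (\<integral>\<^sup>+ w. ennreal (Mx w) \<partial>M) + (\<integral>\<^sup>+ w. ennreal (q w) \<partial>M)"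
    using Mxm quad(1) by (subst nn_integral_add) (auto simp: nn_integral_cmult)
  also have "\<dots> \<le> ennreal l * (\<integral>\<^sup>+ w. ennreal (Mx w) \<partial>M) + ennreal (2 * sigma\<^sup>2) * (\<integral>\<^sup>+ w. ennreal (rk w) \<partial>M)"
    by (intro add_left_mono noise)
  finally show ?thesis
    unfolding Let_def S_def l_def Mx_def rk_def by (rule mult_left_mono) simp
qed

end
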